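(* Let $N\ge 1$ and let $\mathbf{A},\mathbf{B},\mathbf{C}$ be $N\times N$ complex matrices with $\mathbf{A}$ invertible. Let $$\mathbf{M}(\lambda)=\begin{bmatrix}\lambda\mathbf{1} & -\mathbf{1}\\ \mathbf{A}^{-1}\mathbf{C} & \lambda\mathbf{1}+\mathbf{A}^{-1}\mathbf{B}\end{bmatrix},\qquad \mathbf{S}(\lambda)=\lambda^{2}\mathbf{1}+\lambda\mathbf{A}^{-1}\mathbf{B}+\mathbf{A}^{-1}\mathbf{C}.$$ Then $\mathbf{M}(\lambda)$ is diagonalizable if and only if, for each eigenvalue of $\mathbf{S}(\lambda)$, the geometric and algebraic multiplicities are equal.
   Context: The matrices arise from a constant-coefficient second-order system $(\mathbf{A}\partial_t^2+\mathbf{B}^i\partial_i\partial_t+\mathbf{C}^{ij}\partial_i\partial_j)\phi=0$ with $\mathbf{A}$ invertible, by fixing a unit wave covector $\hat k_i$ and putting $\mathbf{B}=\mathbf{B}^i\hat k_i$, $\mathbf{C}=\mathbf{C}^{ij}\hat k_i\hat k_j$. Here $\mathbf{1}$ is the $N\times N$ identity; $\mathbf{M}(\lambda)$ is a $2N\times 2N$ matrix (first-order pencil) and $\mathbf{S}(\lambda)$ an $N\times N$ matrix (second-order pencil), both depending polynomially on $\lambda\in\mathbb{C}$. $\mathbf{M}(\lambda)$ is called diagonalizable if there are an invertible $2N\times 2N$ matrix $\mathbf{P}$ and a diagonal $2N\times 2N$ matrix $\mathbf{D}$, both independent of $\lambda$, with $\mathbf{M}(\lambda)=\mathbf{P}(\lambda\mathbf{1}_{2N}-\mathbf{D})\mathbf{P}^{-1}$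 for all $\lambda$. An eigenvalue of $\mathbf{S}(\lambda)$ is a $\sigma\in\mathbb{C}$ with $\det\mathbf{S}(\sigma)=0$. Its algebraic multiplicity is the multiplicity of $\sigma$ as a root of the polynomial $\det\mathbf{S}(\lambda)$ (of degree $2N$); its geometric multiplicity is $\dim\ker\mathbf{S}(\sigma)$. *)

theory Defs
  imports
    Complex_Main
    "Jordan_Normal_Form.Matrix_Kernel"
    "Jordan_Normal_Form.Gauss_Jordan_Elimination"
begin

(* The value is meaningful only for invertible square matrices, see the lemma mat_inv. *)
definition mat_inv :: "'a :: field mat \<Rightarrow> 'a mat" where
  "mat_inv A = the (mat_inverse A)"

lemma mat_inv:
  assumes A: "A \<in> carrier_mat n n" and inv: "invertible_mat A"
  shows "mat_inv A \<in> carrier_mat n n" "A * mat_inv A = 1\<^sub>m n" "mat_inv A * A = 1\<^sub>m n"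
proof -
  from inv obtain B where B: "A * B = 1\<^sub>m (dim_row A)" "B * A = 1\<^sub>m (dim_row B)"
    unfolding invertible_mat_def inverts_mat_def by blast
  have "dim_col B = n"
    using arg_cong[OF B(1), of dim_col] A by simp
  moreover have "dim_row B = n"
    using arg_cong[OF B(2), of dim_col] A by simp
  ultimately have "A \<in> Units (ring_mat TYPE('a) n ())"
    using A B unfolding Units_def ring_mat_def by auto
  then obtain C where C: "mat_inverse A = Some C"
    using mat_inverse(1)[OF A, where b = "()"] by (cases "mat_inverse A") auto
  then show "mat_inv A \<in> carrier_mat n n" "A * mat_inv A = 1\<^sub>m n" "mat_inv A * A = 1\<^sub>m n"
    using mat_inverse(2)[OF A C] unfolding mat_inv_def by auto
qed

definition first_order_pencil ::
    "complex mat \<Rightarrow> complex mat \<Rightarrow> complex mat \<Rightarrow> complex \<Rightarrow> complex mat" where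
  "first_order_pencil A B C z = (let N = dim_row A in
     four_block_mat
       (z \<cdot>\<^sub>m 1\<^sub>m N)      (- 1\<^sub>m N)
       (mat_inv A * C)   (z \<cdot>\<^sub>m 1\<^sub>m N + mat_inv A * B))"

definition second_order_pencil ::
    "complex mat \<Rightarrow> complex mat \<Rightarrow> complex mat \<Rightarrow> complex \<Rightarrow> complex mat" where
  "second_order_pencil A B C z =
     z\<^sup>2 \<cdot>\<^sub>m 1\<^sub>m (dim_row A) + z \<cdot>\<^sub>m (mat_inv A * B) + mat_inv A * C"

(* The same expression over the ring of polynomials, with z replaced by the indeterminate
   [:0, 1:]; its determinant is the polynomial det S, see poly_det_second_order_pencil. *)
definition second_order_pencil_poly ::
    "complex mat \<Rightarrow> complex mat \<Rightarrow> complex mat \<Rightarrow> complex poly mat" where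
  "second_order_pencil_poly A B C =
     [:0, 1:]\<^sup>2 \<cdot>\<^sub>m 1\<^sub>m (dim_row A) + [:0, 1:] \<cdot>\<^sub>m map_mat (\<lambda>a. [:a:]) (mat_inv A * B)
       + map_mat (\<lambda>a. [:a:]) (mat_inv A * C)"

lemma poly_det_second_order_pencil:
  assumes "A \<in> carrier_mat n n" "B \<in> carrier_mat n n" "C \<in> carrier_mat n n"
    and "invertible_mat A"
  shows "poly (det (second_order_pencil_poly A B C)) z = det (second_order_pencil A B C z)"
proof -
  interpret comm_ring_hom "\<lambda>p :: complex poly. poly p z"
    by unfold_locales auto
  have "map_mat (\<lambda>p. poly p z) (second_order_pencil_poly A B C) = second_order_pencil A B C z"
    unfolding second_order_pencil_poly_def second_order_pencil_def
    using assms mat_inv(1)[OF assms(1,4)]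
    by (intro eq_matI) auto
  then show ?thesis
    using hom_det[of "second_order_pencil_poly A B C"] by simp
qed

definition pencil_diagonalizable :: "nat \<Rightarrow> (complex \<Rightarrow> complex mat) \<Rightarrow> bool" where
  "pencil_diagonalizable n F \<longleftrightarrow>
     (\<exists>P D. P \<in> carrier_mat n n \<and> invertible_mat P \<and> D \<in> carrier_mat n n \<and> diagonal_mat D \<and>
        (\<forall>z. F z = P * (z \<cdot>\<^sub>m 1\<^sub>m n - D) * mat_inv P))"

definition pencil_eigenvalue :: "(complex \<Rightarrow> complex mat) \<Rightarrow> complex \<Rightarrow> bool" where
  "pencil_eigenvalue F s \<longleftrightarrow> det (F s) = 0"

definition geometric_multiplicity :: "(complex \<Rightarrow> complex mat) \<Rightarrow> complex \<Rightarrow> nat" where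
  "geometric_multiplicity F s = kernel_dim (F s)"

(* Stated for a polynomial matrix, so that the determinant is a polynomial. *)
definition algebraic_multiplicity :: "complex poly mat \<Rightarrow> complex \<Rightarrow> nat" where
  "algebraic_multiplicity Q s = Polynomial.order s (det Q)"

end

theory Submission
  imports
    Defs
    "Jordan_Normal_Form.Jordan_Normal_Form_Existence"
    "Jordan_Normal_Form.Jordan_Normal_Form_Uniqueness"
begin

text \<open>
  Put \<open>X = A\<^sup>-\<^sup>1 C\<close> and \<open>Y = A\<^sup>-\<^sup>1 B\<close>. Then \<open>M(z) = z 1 - T\<close>, where \<open>T\<close> is the block
  companion matrix \<open>(0, 1; -X, -Y)\<close>, so that the diagonalizability of the pencil \<open>M\<close> is the
  diagonalizability of the single matrix \<open>T\<close> by similarity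
  (\<open>pencil_diagonalizable_iff_similar_diagonal\<close>).

  The multiplicities of the eigenvalues of \<open>T\<close> are those of the quadratic pencil \<open>S\<close>: block row and
  column operations of determinant 1 turn \<open>M(z)\<close> into the block diagonal matrix of \<open>S(z)\<close> and the
  identity (\<open>companion_linearization_factorization\<close>). Determinants and dimensions of kernels
  survive this. Hence \<open>det S\<close> is the characteristic polynomial of \<open>T\<close>, and \<open>S(s)\<close> and \<open>s 1 - T\<close> have
  kernels of the same dimension for every \<open>s\<close>.

  What remains is the classical criterion that a complex matrix is similar to a diagonal one iff
  for each eigenvalue the geometric and algebraic multiplicities agree
  (\<open>similar_diagonal_iff_multiplicities\<close>). In a Jordan normal form the former counts the blocks
  of the eigenvalue and the latter adds up their sizes, so the two agree exactly if all these
  blocks have size 1.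
\<close>

section \<open>Kernels of equivalent matrices\<close>

lemma kernel_dim_equivalent:
  fixes B :: "'a :: field mat"
  assumes B: "B \<in> carrier_mat n n" and F: "F \<in> carrier_mat n n" and G: "G \<in> carrier_mat n n"
    and detF: "det F \<noteq> 0" and detG: "det G \<noteq> 0"
  shows "kernel_dim (F * B * G) = kernel_dim B"
proof -
  obtain F' where F': "F' \<in> carrier_mat n n" "F' * F = 1\<^sub>m n"
    using det_non_zero_imp_unit[OF F detF, of "()"] unfolding Units_def by (auto simp: ring_mat_def)
  obtain G' where G': "G' \<in> carrier_mat n n" "G * G' = 1\<^sub>m n"
    using det_non_zero_imp_unit[OF G detG, of "()"] unfolding Units_def by (auto simp: ring_mat_def)
  have "kernel.dim n (F * B * G) = kernel.dim n (F * B)"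
    by (rule mat_kernel_dim_mult_eq_right[OF _ G G'(1,2)]) (use F B in auto)
  moreover have "mat_kernel (F * B) = mat_kernel B"
    by (rule mat_kernel_mult_eq[OF B F F'(1,2)])
  ultimately show ?thesis
    unfolding kernel_dim_def using F B G by simp
qed

lemma kernel_dim_append_one:
  fixes S :: "'a :: field mat"
  assumes S: "S \<in> carrier_mat n n"
  shows "kernel_dim (four_block_mat S (0\<^sub>m n m) (0\<^sub>m m n) (1\<^sub>m m)) = kernel_dim S"
  using kernel_four_block_0_mat[OF refl S, of "1\<^sub>m m"] kernel_one_mat(1)[of m, where ?'a = 'a] S
  unfolding kernel_dim_def by simp

section \<open>The companion linearization\<close>

text \<open>
  This is the first-order form of \<open>u'' + Y u' + X u = 0\<close> in the unknowns \<open>(u, u')\<close>.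
\<close>

definition companion_linearization :: "'a :: comm_ring_1 mat \<Rightarrow> 'a mat \<Rightarrow> 'a mat" where
  "companion_linearization X Y = (let n = dim_row X in
     four_block_mat (0\<^sub>m n n) (1\<^sub>m n) (- X) (- Y))"

lemma companion_linearization_carrier [simp]:
  assumes "X \<in> carrier_mat n n" "Y \<in> carrier_mat n n"
  shows "companion_linearization X Y \<in> carrier_mat (n + n) (n + n)"
  using assms unfolding companion_linearization_def by (auto simp: Let_def)

definition quadratic_pencil :: "'a :: comm_ring_1 mat \<Rightarrow> 'a mat \<Rightarrow> 'a \<Rightarrow> 'a mat" where
  "quadratic_pencil X Y z = z\<^sup>2 \<cdot>\<^sub>m 1\<^sub>m (dim_row X) + z \<cdot>\<^sub>m Y + X"

lemma char_matrix_companion: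
  fixes X :: "'a :: field mat"
  assumes X: "X \<in> carrier_mat n n" and Y: "Y \<in> carrier_mat n n"
  shows "- char_matrix (companion_linearization X Y) z =
    four_block_mat (z \<cdot>\<^sub>m 1\<^sub>m n) (- 1\<^sub>m n) X (z \<cdot>\<^sub>m 1\<^sub>m n + Y)"
  using X Y unfolding char_matrix_def companion_linearization_def Let_def
  by (intro eq_matI) auto

text \<open>
  Adding \<open>z\<close> times the second block column of \<open>M(z) = (z 1, -1; X, z 1 + Y)\<close> to the first one gives
  \<open>(0, -1; S(z), z 1 + Y)\<close>; the row operation \<open>(z 1 + Y, 1; -1, 0)\<close> then clears the block \<open>z 1 + Y\<close>
  and exchanges the two block rows. The matrices \<open>F\<close> and \<open>G\<close> below are the inverses of these row and
  column operations.
\<close>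

lemma companion_linearization_factorization:
  fixes X :: "'a :: field mat"
  assumes X: "X \<in> carrier_mat n n" and Y: "Y \<in> carrier_mat n n"
  obtains F G where "F \<in> carrier_mat (n + n) (n + n)" "G \<in> carrier_mat (n + n) (n + n)"
    and "det F = 1" "det G = 1"
    and "- char_matrix (companion_linearization X Y) z =
      F * four_block_mat (quadratic_pencil X Y z) (0\<^sub>m n n) (0\<^sub>m n n) (1\<^sub>m n) * G"
proof -
  define W where "W = z \<cdot>\<^sub>m 1\<^sub>m n + Y"
  define S where "S = quadratic_pencil X Y z"
  define F where "F = four_block_mat (0\<^sub>m n n) (- 1\<^sub>m n) (1\<^sub>m n) W"
  define G where "G = four_block_mat (1\<^sub>m n) (0\<^sub>m n n) ((- z) \<cdot>\<^sub>m 1\<^sub>m n) (1\<^sub>m n)"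
  have W: "W \<in> carrier_mat n n" and S: "S \<in> carrier_mat n n"
    using X Y unfolding W_def S_def quadratic_pencil_def by auto
  have F: "F \<in> carrier_mat (n + n) (n + n)" and G: "G \<in> carrier_mat (n + n) (n + n)"
    using W unfolding F_def G_def by auto
  \<comment> \<open>The lower left block of \<open>F\<close> is the identity, so it commutes with the lower right one.\<close>
  have "det F = det (0\<^sub>m n n * W - (- 1\<^sub>m n) * 1\<^sub>m n)"
    unfolding F_def by (rule det_four_block_mat) (use W in auto)
  also have "0\<^sub>m n n * W - (- 1\<^sub>m n) * 1\<^sub>m n = (1\<^sub>m n :: 'a mat)"
    using W by (intro eq_matI) auto
  finally have detF: "det F = 1" by simp
  have detG: "det G = 1"
    unfolding G_def by (subst det_four_block_mat_upper_right_zero[of _ n _ n]) auto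
  have WS: "S - z \<cdot>\<^sub>m W = X"
    using X Y unfolding S_def W_def quadratic_pencil_def
    by (intro eq_matI) (auto simp: power2_eq_square algebra_simps)
  have "four_block_mat S (0\<^sub>m n n) (0\<^sub>m n n) (1\<^sub>m n) * G =
      four_block_mat S (0\<^sub>m n n) ((- z) \<cdot>\<^sub>m 1\<^sub>m n) (1\<^sub>m n)"
    unfolding G_def using S
    by (subst mult_four_block_mat[of _ n n _ n _ n]) auto
  then have "F * (four_block_mat S (0\<^sub>m n n) (0\<^sub>m n n) (1\<^sub>m n) * G) =
      four_block_mat (0\<^sub>m n n * S + (- 1\<^sub>m n) * ((- z) \<cdot>\<^sub>m 1\<^sub>m n)) (0\<^sub>m n n * 0\<^sub>m n n + (- 1\<^sub>m n) * 1\<^sub>m n)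
        (1\<^sub>m n * S + W * ((- z) \<cdot>\<^sub>m 1\<^sub>m n)) (1\<^sub>m n * 0\<^sub>m n n + W * 1\<^sub>m n)"
    unfolding F_def using S W
    by (simp add: mult_four_block_mat[of _ n n _ n _ n _ _ n _ n])
  also have "\<dots> = four_block_mat (z \<cdot>\<^sub>m 1\<^sub>m n) (- 1\<^sub>m n) X W"
  proof (rule cong_four_block_mat)
    show "0\<^sub>m n n * S + (- 1\<^sub>m n) * ((- z) \<cdot>\<^sub>m 1\<^sub>m n) = z \<cdot>\<^sub>m 1\<^sub>m n"
      using S by (intro eq_matI) auto
    show "0\<^sub>m n n * 0\<^sub>m n n + (- 1\<^sub>m n) * 1\<^sub>m n = (- 1\<^sub>m n :: 'a mat)"
      by (intro eq_matI) auto
    have "W * ((- z) \<cdot>\<^sub>m 1\<^sub>m n) = (- z) \<cdot>\<^sub>m W"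
      using W by (simp add: mult_smult_distrib[OF W one_carrier_mat])
    then have "1\<^sub>m n * S + W * ((- z) \<cdot>\<^sub>m 1\<^sub>m n) = S - z \<cdot>\<^sub>m W"
      using S W by (intro eq_matI) auto
    then show "1\<^sub>m n * S + W * ((- z) \<cdot>\<^sub>m 1\<^sub>m n) = X"
      using WS by simp
    show "1\<^sub>m n * 0\<^sub>m n n + W * 1\<^sub>m n = W"
      using W by simp
  qed
  also have "\<dots> = - char_matrix (companion_linearization X Y) z"
    unfolding char_matrix_companion[OF X Y] W_def ..
  finally have "- char_matrix (companion_linearization X Y) z =
      F * four_block_mat S (0\<^sub>m n n) (0\<^sub>m n n) (1\<^sub>m n) * G"
    using F G S by (simp add: assoc_mult_mat[of F "n + n" "n + n" _ "n + n" G "n + n"])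
  then show ?thesis
    using that F G detF detG unfolding S_def by blast
qed

lemma char_poly_companion_linearization:
  fixes X :: "'a :: field mat"
  assumes X: "X \<in> carrier_mat n n" and Y: "Y \<in> carrier_mat n n"
  shows "poly (char_poly (companion_linearization X Y)) z = det (quadratic_pencil X Y z)"
proof -
  have S: "quadratic_pencil X Y z \<in> carrier_mat n n"
    using X Y unfolding quadratic_pencil_def by auto
  obtain F G where FG: "F \<in> carrier_mat (n + n) (n + n)" "G \<in> carrier_mat (n + n) (n + n)"
      "det F = 1" "det G = 1"
    and eq: "- char_matrix (companion_linearization X Y) z =
      F * four_block_mat (quadratic_pencil X Y z) (0\<^sub>m n n) (0\<^sub>m n n) (1\<^sub>m n) * G"
    using companion_linearization_factorization[OF X Y] by blast
  let ?B = "four_block_mat (quadratic_pencil X Y z) (0\<^sub>m n n) (0\<^sub>m n n) (1\<^sub>m n)"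
  have B: "?B \<in> carrier_mat (n + n) (n + n)" using S by auto
  have "det (F * ?B * G) = det ?B"
    using FG B by (simp add: det_mult[of _ "n + n"])
  also have "\<dots> = det (quadratic_pencil X Y z)"
    using S by (subst det_four_block_mat_upper_right_zero[of _ n _ n]) auto
  finally show ?thesis
    using char_poly_matrix[OF companion_linearization_carrier[OF X Y]] eq by simp
qed

lemma kernel_dim_char_matrix_companion:
  fixes X :: "'a :: field mat"
  assumes X: "X \<in> carrier_mat n n" and Y: "Y \<in> carrier_mat n n"
  shows "kernel_dim (char_matrix (companion_linearization X Y) z) =
    kernel_dim (quadratic_pencil X Y z)"
proof -
  have S: "quadratic_pencil X Y z \<in> carrier_mat n n"
    using X Y unfolding quadratic_pencil_def by auto
  obtain F G where FG: "F \<in> carrier_mat (n + n) (n + n)" "G \<in> carrier_mat (n + n) (n + n)"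
      "det F = 1" "det G = 1"
    and eq: "- char_matrix (companion_linearization X Y) z =
      F * four_block_mat (quadratic_pencil X Y z) (0\<^sub>m n n) (0\<^sub>m n n) (1\<^sub>m n) * G"
    using companion_linearization_factorization[OF X Y] by blast
  let ?B = "four_block_mat (quadratic_pencil X Y z) (0\<^sub>m n n) (0\<^sub>m n n) (1\<^sub>m n)"
  have B: "?B \<in> carrier_mat (n + n) (n + n)" using S by auto
  have "char_matrix (companion_linearization X Y) z = - (F * ?B * G)"
    unfolding eq[symmetric] by simp
  also have "\<dots> = - (F * ?B) * G"
    by (rule uminus_mult_left_mat[symmetric])
      (unfold carrier_matD(2)[OF mult_carrier_mat[OF FG(1) B]], simp only: carrier_matD(1)[OF FG(2)])
  also have "- (F * ?B) = (- F) * ?B"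
    by (rule uminus_mult_left_mat[symmetric])
      (unfold carrier_matD(2)[OF FG(1)], simp only: carrier_matD(1)[OF B])
  finally have "kernel_dim (char_matrix (companion_linearization X Y) z) = kernel_dim ((- F) * ?B * G)"
    by simp
  also have "\<dots> = kernel_dim ?B"
    using FG det_0_negate[OF FG(1)] by (intro kernel_dim_equivalent[OF B]) auto
  finally show ?thesis
    using kernel_dim_append_one[OF S] by simp
qed

section \<open>Diagonalizability by multiplicities\<close>

text \<open>
  Both directions of the criterion for diagonalizability need this description: it makes any
  diagonal matrix a Jordan matrix, and it makes a Jordan matrix without larger blocks diagonal.
\<close>

lemma jordan_matrix_size_one_blocks:
  "jordan_matrix (map (Pair 1) as) =
    mat (length as) (length as) (\<lambda>(i, j). if i = j then as ! i else 0)"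
proof (induction as)
  case Nil
  show ?case by (intro eq_matI) auto
next
  case (Cons a as)
  have len: "sum_list (map fst (map (Pair (1 :: nat)) as)) = length as"
    by (induction as) auto
  show ?case
    unfolding list.map jordan_matrix_Cons Cons.IH len
    by (intro eq_matI) (auto simp: nth_Cons')
qed

lemma diagonal_mat_eq_jordan_matrix:
  assumes D: "D \<in> carrier_mat n n" and diag: "diagonal_mat D"
  shows "D = jordan_matrix (map (Pair 1) (diag_mat D))"
  unfolding jordan_matrix_size_one_blocks
  using D diag unfolding diagonal_mat_def diag_mat_def by (intro eq_matI) auto

lemma sum_list_min_one_eq_iff:
  fixes ns :: "nat list"
  assumes "0 \<notin> set ns"
  shows "sum_list (map (min 1) ns) = sum_list ns \<longleftrightarrow> (\<forall>n \<in> set ns. n = 1)"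
proof -
  have "length xs \<le> sum_list xs" if "0 \<notin> set xs" for xs :: "nat list"
    using that by (induction xs) (auto simp: Suc_le_eq)
  then show ?thesis
    using assms
  proof (induction ns)
    case (Cons n ns)
    have le: "sum_list (map (min 1) ns) \<le> sum_list ns"
      by (induction ns) auto
    have "min 1 n = 1" "n \<ge> 1" using Cons.prems(2) by auto
    then show ?case using Cons le by auto
  qed simp
qed

text \<open>
  The Jordan normal form of \<open>T\<close> exists because the characteristic polynomial splits over the complex
  numbers. Its blocks for \<open>s\<close> contribute one dimension each to the kernel of \<open>T - s 1\<close> and their size
  to the order of the root \<open>s\<close>.
\<close>

lemma similar_diagonal_iff_multiplicities:
  fixes T :: "complex mat"
  assumes T: "T \<in> carrier_mat n n"
  shows "(\<exists>D. D \<in> carrier_mat n n \<and> diagonal_mat D \<and> similar_mat T D) \<longleftrightarrow>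
    (\<forall>s. poly (char_poly T) s = 0 \<longrightarrow> kernel_dim (char_matrix T s) = Polynomial.order s (char_poly T))"
    (is "?diag \<longleftrightarrow> ?mult")
proof -
  have nz: "char_poly T \<noteq> 0" using degree_monic_char_poly[OF T] by auto
  have mult_iff: "kernel_dim (char_matrix T s) = Polynomial.order s (char_poly T) \<longleftrightarrow>
      (\<forall>(n, a) \<in> set n_as. a = s \<longrightarrow> n = 1)" if jnf: "jordan_nf T n_as" for n_as s
  proof -
    let ?ns = "map fst (filter (\<lambda>na. snd na = s) n_as)"
    have "dim_gen_eigenspace T s 1 = kernel_dim (char_matrix T s)"
      unfolding dim_gen_eigenspace_def using T by simp
    then have "kernel_dim (char_matrix T s) = sum_list (map (min 1) ?ns)"
      using dim_gen_eigenspace[OF jnf, of s 1] by (simp add: case_prod_unfold)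
    moreover have "0 \<notin> set ?ns"
      using jnf unfolding jordan_nf_def by auto
    ultimately show ?thesis
      using sum_list_min_one_eq_iff[of ?ns] jordan_nf_order[OF jnf, of s] by auto
  qed
  show ?thesis
  proof
    assume ?diag
    then obtain D where D: "D \<in> carrier_mat n n" "diagonal_mat D" "similar_mat T D" by blast
    have "jordan_nf T (map (Pair 1) (diag_mat D))"
      using D(3) diagonal_mat_eq_jordan_matrix[OF D(1,2)] unfolding jordan_nf_def by auto
    from mult_iff[OF this] show ?mult by auto
  next
    assume mult: ?mult
    obtain n_as where jnf: "jordan_nf T n_as"
      using char_poly_factorized[OF T] jordan_nf_exists[OF T] by blast
    \<comment> \<open>The hypothesis speaks of roots only; a block of positive size makes its diagonal entry a root.\<close>
    have one: "m = 1" if mem: "(m, a) \<in> set n_as" for m a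
    proof -
      have "m \<noteq> 0" using jnf mem unfolding jordan_nf_def by force
      then have "Polynomial.order a (char_poly T) \<noteq> 0"
        using jordan_nf_block_size_order_bound[OF jnf mem] by simp
      then have "poly (char_poly T) a = 0" using order_root by blast
      then show ?thesis using mult mult_iff[OF jnf, of a] mem by auto
    qed
    have "map (Pair 1) (map snd n_as) = n_as"
      unfolding map_map by (rule map_idI) (use one in force)
    with jordan_matrix_size_one_blocks[of "map snd n_as"]
    have "diagonal_mat (jordan_matrix n_as)"
      unfolding diagonal_mat_def by auto
    moreover have sim: "similar_mat T (jordan_matrix n_as)"
      using jnf unfolding jordan_nf_def by blast
    moreover have "jordan_matrix n_as \<in> carrier_mat n n"
      using similar_matD[OF sim] T by auto
    ultimately show ?diag by blast
  qed
qed

section \<open>Diagonalizability of a monic linear pencil\<close>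

lemma conjugate_linear_pencil:
  fixes D :: "'a :: comm_ring_1 mat"
  assumes P: "P \<in> carrier_mat n n" and D: "D \<in> carrier_mat n n" and Q: "Q \<in> carrier_mat n n"
    and PQ: "P * Q = 1\<^sub>m n"
  shows "P * (z \<cdot>\<^sub>m 1\<^sub>m n - D) * Q = z \<cdot>\<^sub>m 1\<^sub>m n - P * D * Q"
proof -
  have "P * (z \<cdot>\<^sub>m 1\<^sub>m n - D) = z \<cdot>\<^sub>m P - P * D"
    using P D by (simp add: mult_minus_distrib_mat[OF P _ D] mult_smult_distrib[OF P one_carrier_mat])
  then show ?thesis
    using P D Q PQ by (simp add: minus_mult_distrib_mat[of _ n n _ Q n] mult_smult_assoc_mat[OF P Q])
qed

text \<open>
  Conjugation leaves \<open>z 1\<close> unchanged, so \<open>P\<close> and \<open>D\<close> diagonalize the pencil \<open>z 1 - T\<close> iff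
  \<open>T = P D P\<^sup>-\<^sup>1\<close>; evaluation at \<open>z = 0\<close> gives the forward direction. The sign in the hypothesis
  on \<open>F\<close> is there because \<open>char_matrix T z\<close> stands for \<open>T - z 1\<close>.
\<close>

lemma pencil_diagonalizable_iff_similar_diagonal:
  assumes T: "T \<in> carrier_mat n n" and F: "\<And>z. F z = - char_matrix T z"
  shows "pencil_diagonalizable n F \<longleftrightarrow>
    (\<exists>D. D \<in> carrier_mat n n \<and> diagonal_mat D \<and> similar_mat T D)"
proof -
  have F': "F z = z \<cdot>\<^sub>m 1\<^sub>m n - T" for z
    unfolding F char_matrix_def using T by (intro eq_matI) auto
  show ?thesis
  proof
    assume "pencil_diagonalizable n F"
    then obtain P D where P: "P \<in> carrier_mat n n" "invertible_mat P"
      and D: "D \<in> carrier_mat n n" "diagonal_mat D"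
      and eq: "\<And>z. F z = P * (z \<cdot>\<^sub>m 1\<^sub>m n - D) * mat_inv P"
      unfolding pencil_diagonalizable_def by blast
    note Q = mat_inv[OF P]
    have PDQ: "P * D * mat_inv P \<in> carrier_mat n n" using P D Q by auto
    have "0 \<cdot>\<^sub>m 1\<^sub>m n - T = 0 \<cdot>\<^sub>m 1\<^sub>m n - P * D * mat_inv P"
      using eq[of 0] F' conjugate_linear_pencil[OF P(1) D(1) Q(1,2)] by simp
    moreover have "- (0 \<cdot>\<^sub>m 1\<^sub>m n - R) = R" if "R \<in> carrier_mat n n" for R :: "complex mat"
      using that by (intro eq_matI) auto
    ultimately have "T = P * D * mat_inv P"
      using T PDQ by metis
    then have "similar_mat T D"
      using T P D Q by (intro similar_matI[of _ _ P "mat_inv P" n]) auto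
    with D show "\<exists>D. D \<in> carrier_mat n n \<and> diagonal_mat D \<and> similar_mat T D" by blast
  next
    assume "\<exists>D. D \<in> carrier_mat n n \<and> diagonal_mat D \<and> similar_mat T D"
    then obtain D P Q where D: "D \<in> carrier_mat n n" "diagonal_mat D"
      and wit: "similar_mat_wit T D P Q"
      unfolding similar_mat_def by blast
    note w = similar_mat_witD2[OF T wit]
    have inv: "invertible_mat P"
      using w unfolding invertible_mat_def inverts_mat_def by auto
    note R = mat_inv[OF w(6) inv]
    have "mat_inv P = (Q * P) * mat_inv P"
      using w(2) R(1) by simp
    also have "\<dots> = Q"
      unfolding assoc_mult_mat[OF w(7) w(6) R(1)] R(2) using w(7) by simp
    finally have "\<forall>z. F z = P * (z \<cdot>\<^sub>m 1\<^sub>m n - D) * mat_inv P"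
      using conjugate_linear_pencil[OF w(6) D(1) w(7) w(1)] w(3) F' by metis
    with D w(6) inv show "pencil_diagonalizable n F"
      unfolding pencil_diagonalizable_def by blast
  qed
qed

section \<open>The first-order and the second-order pencil\<close>

theorem theorem1:
  fixes N :: nat and A B C :: "complex mat"
  assumes "N \<ge> 1"
    and "A \<in> carrier_mat N N" and "B \<in> carrier_mat N N" and "C \<in> carrier_mat N N"
    and "invertible_mat A"
  shows "pencil_diagonalizable (2 * N) (first_order_pencil A B C) \<longleftrightarrow>
    (\<forall>s. pencil_eigenvalue (second_order_pencil A B C) s \<longrightarrow>
       geometric_multiplicity (second_order_pencil A B C) s =
       algebraic_multiplicity (second_order_pencil_poly A B C) s)"
proof -
  define X where "X = mat_inv A * C"
  define Y where "Y = mat_inv A * B"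
  define T where "T = companion_linearization X Y"
  have XY: "X \<in> carrier_mat N N" "Y \<in> carrier_mat N N"
    using assms mat_inv(1)[OF assms(2,5)] unfolding X_def Y_def by auto
  have T: "T \<in> carrier_mat (2 * N) (2 * N)"
    using companion_linearization_carrier[OF XY] unfolding T_def mult_2 .
  have M: "first_order_pencil A B C z = - char_matrix T z" for z
    using assms(2) unfolding T_def char_matrix_companion[OF XY]
    by (simp add: first_order_pencil_def X_def Y_def)
  have S: "second_order_pencil A B C = quadratic_pencil X Y"
    using XY(1) assms(2)
    by (intro ext) (simp add: quadratic_pencil_def second_order_pencil_def flip: X_def Y_def)
  have detS: "det (second_order_pencil_poly A B C) = char_poly T"
  proof (rule poly_ext)
    show "poly (det (second_order_pencil_poly A B C)) z = poly (char_poly T) z" for z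
      unfolding T_def char_poly_companion_linearization[OF XY]
        poly_det_second_order_pencil[OF assms(2-5)] S ..
  qed
  have "pencil_diagonalizable (2 * N) (first_order_pencil A B C) \<longleftrightarrow>
      (\<forall>s. poly (char_poly T) s = 0 \<longrightarrow>
        kernel_dim (char_matrix T s) = Polynomial.order s (char_poly T))"
    using pencil_diagonalizable_iff_similar_diagonal[OF T M]
      similar_diagonal_iff_multiplicities[OF T] by simp
  then show ?thesis
    unfolding pencil_eigenvalue_def geometric_multiplicity_def algebraic_multiplicity_def detS S
    unfolding T_def char_poly_companion_linearization[OF XY] kernel_dim_char_matrix_companion[OF XY] .
qed

end
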